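(* Let $G$ be a finite $2$-edge-connected graph (multiple edges allowed, no loops) that is not a regular bipartite graph. Let $w \in V(G)$ and $\lambda \in \{0,1\}$. Then $G$ has a spanning weakly even $(w,\lambda)$-tree.
   Context: Graphs are finite, may have multiple edges, but no loops. $\Delta(G)$ denotes the maximum degree of $G$. Given an ordered bipartition $(X,Y)$ of a bipartite graph $H$, a vertex of $H$ is type-$0$ if it lies in $X$ and type-$1$ if it lies in $Y$. For $w \in V(H)$ and $\lambda \in \{0,1\}$, the $(w,\lambda)$-bipartition of a connected bipartite graph $H$ is the ordered bipartition of $H$ in which $w$ has type $\lambda$; a $(w,\lambda)$-tree is a tree equipped with its $(w,\lambda)$-bipartition. A tree $T \subseteq G$ with ordered bipartition $(X,Y)$ is weakly even (in $G$) if every leaf of $T$ that has degree $\Delta(G)$ in $G$ is type-$0$ (i.e. lies in $X$). *)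

theory Defs
  imports Main
begin

record ('a, 'e) mgraph =
  verts :: "'a set"
  edges :: "'e set"
  ends :: "'e \<Rightarrow> 'a set"

text \<open>
  Finite undirected graphs. Edges are named objects mapped to their sets of end vertices,
  so parallel edges are allowed; loops are excluded because every edge has exactly two ends.
  The value of \<open>ends\<close> outside \<open>edges G\<close> is irrelevant.
\<close>

definition mgraph :: "('a, 'e) mgraph \<Rightarrow> bool" where
  "mgraph G \<longleftrightarrow> finite (verts G) \<and> finite (edges G) \<and>
     (\<forall>e\<in>edges G. ends G e \<subseteq> verts G \<and> card (ends G e) = 2)"

definition degree :: "('a, 'e) mgraph \<Rightarrow> 'a \<Rightarrow> nat" where
  "degree G v = card {e \<in> edges G. v \<in> ends G e}"

definition max_degree :: "('a, 'e) mgraph \<Rightarrow> nat" where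
  "max_degree G = Max (degree G ` verts G)"

definition regular :: "('a, 'e) mgraph \<Rightarrow> bool" where
  "regular G \<longleftrightarrow> (\<exists>d. \<forall>v\<in>verts G. degree G v = d)"

definition subgraph :: "('a, 'e) mgraph \<Rightarrow> ('a, 'e) mgraph \<Rightarrow> bool" where
  "subgraph H G \<longleftrightarrow> mgraph H \<and> mgraph G \<and> verts H \<subseteq> verts G \<and> edges H \<subseteq> edges G \<and>
     (\<forall>e\<in>edges H. ends H e = ends G e)"

definition spanning_subgraph :: "('a, 'e) mgraph \<Rightarrow> ('a, 'e) mgraph \<Rightarrow> bool" where
  "spanning_subgraph H G \<longleftrightarrow> subgraph H G \<and> verts H = verts G"

definition delete_edges :: "('a, 'e) mgraph \<Rightarrow> 'e set \<Rightarrow> ('a, 'e) mgraph" where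
  "delete_edges G F = G\<lparr>edges := edges G - F\<rparr>"

text \<open>
  A walk is given by its start vertex and the list of its steps, each step consisting of the
  edge traversed and the vertex reached by it.
\<close>

fun walk :: "('a, 'e) mgraph \<Rightarrow> 'a \<Rightarrow> ('e \<times> 'a) list \<Rightarrow> 'a \<Rightarrow> bool" where
  "walk G u [] v \<longleftrightarrow> u \<in> verts G \<and> u = v"
| "walk G u ((e, x) # p) v \<longleftrightarrow>
     u \<in> verts G \<and> e \<in> edges G \<and> ends G e = {u, x} \<and> walk G x p v"

definition connected :: "('a, 'e) mgraph \<Rightarrow> bool" where
  "connected G \<longleftrightarrow> verts G \<noteq> {} \<and> (\<forall>u\<in>verts G. \<forall>v\<in>verts G. \<exists>p. walk G u p v)"

definition edge_connected :: "nat \<Rightarrow> ('a, 'e) mgraph \<Rightarrow> bool" where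
  "edge_connected k G \<longleftrightarrow> card (verts G) > 1 \<and>
     (\<forall>F. F \<subseteq> edges G \<and> card F < k \<longrightarrow> connected (delete_edges G F))"

text \<open>
  Distinctness of the edges only matters for cycles of length two: it makes a pair of
  parallel edges a cycle, but not a single edge traversed back and forth.
\<close>

definition cycle :: "('a, 'e) mgraph \<Rightarrow> 'a \<Rightarrow> ('e \<times> 'a) list \<Rightarrow> bool" where
  "cycle G u p \<longleftrightarrow> p \<noteq> [] \<and> walk G u p u \<and> distinct (map fst p) \<and> distinct (map snd p)"

definition tree :: "('a, 'e) mgraph \<Rightarrow> bool" where
  "tree T \<longleftrightarrow> mgraph T \<and> connected T \<and> \<not> (\<exists>u p. cycle T u p)"

definition leaf :: "('a, 'e) mgraph \<Rightarrow> 'a \<Rightarrow> bool" where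
  "leaf T v \<longleftrightarrow> v \<in> verts T \<and> degree T v = 1"

definition ordered_bipartition :: "('a, 'e) mgraph \<Rightarrow> 'a set \<Rightarrow> 'a set \<Rightarrow> bool" where
  "ordered_bipartition H X Y \<longleftrightarrow> X \<union> Y = verts H \<and> X \<inter> Y = {} \<and>
     (\<forall>e\<in>edges H. \<exists>x\<in>X. \<exists>y\<in>Y. ends H e = {x, y})"

definition bipartite :: "('a, 'e) mgraph \<Rightarrow> bool" where
  "bipartite H \<longleftrightarrow> (\<exists>X Y. ordered_bipartition H X Y)"

definition has_type :: "'a set \<Rightarrow> 'a set \<Rightarrow> 'a \<Rightarrow> nat \<Rightarrow> bool" where
  "has_type X Y v t \<longleftrightarrow> (t = 0 \<and> v \<in> X) \<or> (t = 1 \<and> v \<in> Y)"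

text \<open>
  A connected bipartite graph has exactly two ordered bipartitions, which are interchanged by
  swapping the parts, so for connected \<open>H\<close> with \<open>w \<in> verts H\<close> and \<open>t \<in> {0, 1}\<close> this
  predicate determines \<open>X\<close> and \<open>Y\<close>.
\<close>

definition wt_bipartition ::
  "('a, 'e) mgraph \<Rightarrow> 'a \<Rightarrow> nat \<Rightarrow> 'a set \<Rightarrow> 'a set \<Rightarrow> bool" where
  "wt_bipartition H w t X Y \<longleftrightarrow> ordered_bipartition H X Y \<and> has_type X Y w t"

definition wt_tree ::
  "('a, 'e) mgraph \<Rightarrow> 'a set \<Rightarrow> 'a set \<Rightarrow> 'a \<Rightarrow> nat \<Rightarrow> bool" where
  "wt_tree T X Y w t \<longleftrightarrow> tree T \<and> w \<in> verts T \<and> wt_bipartition T w t X Y"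

definition weakly_even ::
  "('a, 'e) mgraph \<Rightarrow> ('a, 'e) mgraph \<Rightarrow> 'a set \<Rightarrow> 'a set \<Rightarrow> bool" where
  "weakly_even G T X Y \<longleftrightarrow> tree T \<and> subgraph T G \<and> ordered_bipartition T X Y \<and>
     (\<forall>v. leaf T v \<and> degree G v = max_degree G \<longrightarrow> has_type X Y v 0)"

end

(* Among the vertex sets X that give w the right type and whose cut is connected, take a largest
   one. Then in the cut every nonempty set S of maximum-degree vertices outside X has more than
   |S| neighbours: a vertex of a minimal violating S with a neighbour outside X could be moved
   to X, and without such a neighbour edge counting would make G regular bipartite.
   A minimal connected subgraph of the cut that keeps this strict Hall condition is a tree, by the
   submodularity of the neighbourhood size, and the condition for singletons S forbids
   maximum-degree leaves outside X.
   For l = 1 the neighbours of w must lie in X, so that w itself is never moved. *)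
theory Submission
  imports Defs
begin

section \<open>Neighbourhoods, cuts and Hall's condition\<close>

definition nbrs :: "('e \<Rightarrow> 'a set) \<Rightarrow> 'e set \<Rightarrow> 'a set \<Rightarrow> 'a set" where
  "nbrs en F S = {x. \<exists>e\<in>F. \<exists>y\<in>S. en e = {x, y}}"

text \<open>Connectivity is phrased by cuts instead of walks, and the edge set \<open>F\<close> is a
  separate argument because it varies while vertices and ends stay fixed.\<close>

definition cut_connected :: "('e \<Rightarrow> 'a set) \<Rightarrow> 'a set \<Rightarrow> 'e set \<Rightarrow> bool" where
  "cut_connected en V F \<longleftrightarrow>
     (\<forall>A. A \<subseteq> V \<and> A \<noteq> {} \<and> A \<noteq> V \<longrightarrow> (\<exists>e\<in>F. \<exists>u\<in>A. \<exists>v\<in>V - A. en e = {u, v}))"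

definition cut_edges :: "('a, 'e) mgraph \<Rightarrow> 'a set \<Rightarrow> 'e set" where
  "cut_edges G X = {e \<in> edges G. \<exists>x\<in>X. \<exists>y\<in>verts G - X. ends G e = {x, y}}"

text \<open>Hall's condition with surplus one. The surplus gives every vertex of \<open>D\<close> at
  least two neighbours, where plain Hall would allow a leaf.\<close>

definition strict_hall :: "('e \<Rightarrow> 'a set) \<Rightarrow> 'e set \<Rightarrow> 'a set \<Rightarrow> bool" where
  "strict_hall en F D \<longleftrightarrow> (\<forall>S. S \<subseteq> D \<and> S \<noteq> {} \<longrightarrow> card S < card (nbrs en F S))"

lemma cut_connectedE:
  assumes "cut_connected en V F" "A \<subseteq> V" "A \<noteq> {}" "A \<noteq> V"
  obtains e u v where "e \<in> F" "u \<in> A" "v \<in> V" "v \<notin> A" "en e = {u, v}"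
  using assms unfolding cut_connected_def by (metis DiffE)

text \<open>A set and its complement are separated by the same edges, so it suffices to test the one
  of the two that avoids a chosen vertex.\<close>

lemma cut_connectedI:
  assumes "w \<in> V"
    and cross: "\<And>A. A \<subseteq> V \<Longrightarrow> A \<noteq> {} \<Longrightarrow> w \<notin> A \<Longrightarrow> \<exists>e\<in>F. \<exists>u\<in>A. \<exists>v\<in>V - A. en e = {u, v}"
  shows "cut_connected en V F"
  unfolding cut_connected_def
proof (intro allI impI)
  fix A assume A: "A \<subseteq> V \<and> A \<noteq> {} \<and> A \<noteq> V"
  show "\<exists>e\<in>F. \<exists>u\<in>A. \<exists>v\<in>V - A. en e = {u, v}"
  proof (cases "w \<in> A")
    case False
    then show ?thesis using cross A by blast
  next
    case True
    have "V - A \<noteq> {}" using A by blast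
    then obtain e u v where "e \<in> F" "u \<in> V - A" "v \<in> V - (V - A)" "en e = {u, v}"
      using cross[of "V - A"] True by blast
    moreover have "{u, v} = {v, u}" by blast
    ultimately show ?thesis by (metis DiffD1 DiffD2 DiffI)
  qed
qed

lemma mgraph_edge:
  assumes "mgraph G" "e \<in> edges G"
  obtains u v where "ends G e = {u, v}" "u \<noteq> v" "u \<in> verts G" "v \<in> verts G"
proof -
  have "card (ends G e) = 2" "ends G e \<subseteq> verts G" using assms by (auto simp: mgraph_def)
  then show ?thesis using that by (auto simp: card_2_iff)
qed

lemma mgraph_ends_neq:
  assumes "mgraph G" "e \<in> edges G" "ends G e = {u, v}"
  shows "u \<noteq> v" "u \<in> verts G" "v \<in> verts G"
  using assms by (auto simp: mgraph_def)

lemma finite_nbrs: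
  assumes "mgraph G" "F \<subseteq> edges G"
  shows "finite (nbrs (ends G) F S)"
proof (rule finite_subset)
  show "nbrs (ends G) F S \<subseteq> verts G"
    using assms mgraph_ends_neq by (fastforce simp: nbrs_def)
  show "finite (verts G)" using assms by (simp add: mgraph_def)
qed

section \<open>Walks and connectivity\<close>

lemma walk_append:
  "walk G u p v \<Longrightarrow> walk G v q x \<Longrightarrow> walk G u (p @ q) x"
  by (induction G u p v rule: walk.induct) auto

lemma walk_verts: "walk G u p v \<Longrightarrow> u \<in> verts G \<and> v \<in> verts G"
  by (induction G u p v rule: walk.induct) auto

text \<open>The crossing edge is found on the walk itself, so a walk that avoids an edge gives a
  crossing edge different from it.\<close>

lemma walk_crosses:
  "walk G u p v \<Longrightarrow> u \<in> A \<Longrightarrow> v \<notin> A \<Longrightarrow>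
   \<exists>e\<in>set (map fst p). \<exists>a\<in>A. \<exists>b\<in>verts G - A. e \<in> edges G \<and> ends G e = {a, b}"
proof (induction G u p v rule: walk.induct)
  case (2 G u e x p v)
  show ?case
  proof (cases "x \<in> A")
    case True
    then show ?thesis using 2 by auto
  next
    case False
    then show ?thesis using 2 walk_verts by fastforce
  qed
qed auto

lemma connected_cut_connected:
  assumes "connected G"
  shows "cut_connected (ends G) (verts G) (edges G)"
  unfolding cut_connected_def
proof (intro allI impI)
  fix A assume A: "A \<subseteq> verts G \<and> A \<noteq> {} \<and> A \<noteq> verts G"
  then obtain u v where "u \<in> A" "u \<in> verts G" "v \<in> verts G" "v \<notin> A" by blast
  moreover from this obtain p where p: "walk G u p v"
    using assms unfolding connected_def by blast
  ultimately show "\<exists>e\<in>edges G. \<exists>u\<in>A. \<exists>v\<in>verts G - A. ends G e = {u, v}"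
    using walk_crosses[OF p, of A] by blast
qed

lemma cut_connected_connected:
  assumes "cut_connected (ends G) (verts G) (edges G)" "verts G \<noteq> {}"
  shows "connected G"
  unfolding connected_def
proof (intro conjI ballI)
  fix u v assume uv: "u \<in> verts G" "v \<in> verts G"
  define A where "A = {x \<in> verts G. \<exists>p. walk G u p x}"
  have "walk G u [] u" using uv by simp
  then have uA: "u \<in> A" unfolding A_def using uv by blast
  have "A = verts G"
  proof (rule ccontr)
    assume "A \<noteq> verts G"
    then obtain e a b where e: "e \<in> edges G" "a \<in> A" "b \<in> verts G" "b \<notin> A" "ends G e = {a, b}"
      using cut_connectedE[OF assms(1), of A] uA unfolding A_def by blast
    then obtain p where "walk G u p a" "a \<in> verts G" unfolding A_def by blast
    moreover have "walk G a [(e, b)] b" using e \<open>a \<in> verts G\<close> by simp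
    ultimately have "walk G u (p @ [(e, b)]) b" using walk_append by metis
    with e show False unfolding A_def by blast
  qed
  then show "\<exists>p. walk G u p v" using uv unfolding A_def by blast
qed (use assms in simp)

section \<open>Connected cuts that respect the type of the prescribed vertex\<close>

lemma cut_edges_iff:
  assumes "mgraph G" "e \<in> edges G" "ends G e = {u, v}"
  shows "e \<in> cut_edges G X \<longleftrightarrow> (u \<in> X \<longleftrightarrow> v \<notin> X)"
  using assms mgraph_ends_neq[OF assms] unfolding cut_edges_def
  by (auto simp: doubleton_eq_iff)

text \<open>Chosen so that it survives adding to \<open>X\<close> any vertex of \<open>G\<close>
  other than \<open>w\<close>.\<close>

definition typed_part :: "('a, 'e) mgraph \<Rightarrow> 'a \<Rightarrow> nat \<Rightarrow> 'a set \<Rightarrow> bool" where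
  "typed_part G w l X \<longleftrightarrow> X \<subseteq> verts G \<and>
     (if l = 0 then w \<in> X else w \<notin> X \<and> nbrs (ends G) (edges G) {w} \<subseteq> X)"

text \<open>A typed part with the most cut edges works: if no cut edge left a set \<open>A\<close>
  avoiding \<open>w\<close>, exchanging the sides of the vertices of \<open>A\<close> would keep
  every cut edge and gain the edges of \<open>G\<close> that leave \<open>A\<close>.\<close>

lemma exists_connected_cut:
  assumes G: "mgraph G" "cut_connected (ends G) (verts G) (edges G)" and w: "w \<in> verts G"
  shows "\<exists>X. typed_part G w l X \<and> cut_connected (ends G) (verts G) (cut_edges G X)"
proof -
  let ?V = "verts G"
  define X0 where "X0 = (if l = 0 then {w} else nbrs (ends G) (edges G) {w})"
  have "nbrs (ends G) (edges G) {w} \<subseteq> ?V"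
    using mgraph_ends_neq(2)[OF G(1)] unfolding nbrs_def by blast
  moreover have "w \<notin> nbrs (ends G) (edges G) {w}"
    using mgraph_ends_neq(1)[OF G(1)] unfolding nbrs_def by blast
  ultimately have "typed_part G w l X0" using w unfolding typed_part_def X0_def by simp
  moreover have fin: "finite (edges G)" using G by (simp add: mgraph_def)
  then have "\<forall>X. typed_part G w l X \<longrightarrow> card (cut_edges G X) < Suc (card (edges G))"
    by (auto simp: cut_edges_def less_Suc_eq_le intro: card_mono)
  ultimately obtain X where X: "typed_part G w l X"
    and max: "\<And>X'. typed_part G w l X' \<Longrightarrow> card (cut_edges G X') \<le> card (cut_edges G X)"
    using ex_has_greatest_nat[of "typed_part G w l" X0 "\<lambda>X. card (cut_edges G X)" "Suc (card (edges G))"]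
    by blast
  have no_flip: "\<exists>e\<in>cut_edges G X. \<exists>u\<in>A. \<exists>v\<in>?V - A. ends G e = {u, v}"
    if A: "A \<subseteq> ?V" "A \<noteq> {}" "w \<notin> A" for A
  proof (rule ccontr)
    assume no: "\<not> ?thesis"
    define X' where "X' = (X - A) \<union> (A - X)"
    \<comment> \<open>For \<open>l \<noteq> 0\<close> every edge at \<open>w\<close> is a cut edge.
      A neighbour of \<open>w\<close> in \<open>A\<close> would give a cut edge leaving
      \<open>A\<close>, so the exchange leaves the neighbours of \<open>w\<close> in
      \<open>X\<close>.\<close>
    have "nbrs (ends G) (edges G) {w} \<inter> A = {}" if "l \<noteq> 0"
    proof (rule ccontr)
      assume "nbrs (ends G) (edges G) {w} \<inter> A \<noteq> {}"
      then obtain v e where v: "v \<in> A" "e \<in> edges G" "ends G e = {v, w}"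
        unfolding nbrs_def by auto
      then have "v \<in> X" "w \<notin> X" using X that unfolding typed_part_def nbrs_def by auto
      then have "e \<in> cut_edges G X" using cut_edges_iff[OF G(1) v(2,3)] by simp
      with no v A w show False by blast
    qed
    then have "typed_part G w l X'"
      using X A unfolding typed_part_def X'_def by auto
    moreover have "cut_edges G X \<subseteq> cut_edges G X'"
    proof
      fix e assume e: "e \<in> cut_edges G X"
      then have eE: "e \<in> edges G" by (simp add: cut_edges_def)
      obtain u v where uv: "ends G e = {u, v}" "u \<in> ?V" "v \<in> ?V"
        using mgraph_edge[OF G(1) eE] by metis
      then have "u \<in> A \<longleftrightarrow> v \<in> A" using no e by (metis DiffI insert_commute)
      then show "e \<in> cut_edges G X'"
        using e cut_edges_iff[OF G(1) eE uv(1)] unfolding X'_def by auto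
    qed
    moreover obtain e u v where e: "e \<in> edges G" "u \<in> A" "v \<in> ?V" "v \<notin> A" "ends G e = {u, v}"
      using cut_connectedE[OF G(2), of A] A w by blast
    moreover have "e \<notin> cut_edges G X" using no e by blast
    moreover from this have "e \<in> cut_edges G X'"
      using e cut_edges_iff[OF G(1) e(1,5)] unfolding X'_def by auto
    moreover have "finite (cut_edges G X')" using fin by (simp add: cut_edges_def)
    ultimately show False using max[of X'] psubset_card_mono[of "cut_edges G X'" "cut_edges G X"]
      by (metis leD psubsetI)
  qed
  have "cut_connected (ends G) ?V (cut_edges G X)" using cut_connectedI[OF w no_flip] by blast
  with X show ?thesis by blast
qed

section \<open>The strict Hall condition for a largest part\<close>

text \<open>Counting the edges at \<open>S\<close> and at \<open>P\<close> shows that no edge leaves \<open>S \<union> P\<close>.\<close>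

lemma tight_set_regular_bipartite:
  assumes G: "mgraph G" "cut_connected (ends G) (verts G) (edges G)"
    and S: "S \<subseteq> verts G" "S \<noteq> {}" "\<And>y. y \<in> S \<Longrightarrow> degree G y = d"
    and P: "P = nbrs (ends G) (edges G) S" "P \<inter> S = {}" "card P \<le> card S"
    and d: "\<And>v. v \<in> verts G \<Longrightarrow> degree G v \<le> d"
  shows "regular G \<and> bipartite G"
proof -
  let ?I = "\<lambda>v. {e \<in> edges G. v \<in> ends G e}"
  have fin: "finite (edges G)" "finite (verts G)" using G by (auto simp: mgraph_def)
  have PV: "P \<subseteq> verts G" using P(1) mgraph_ends_neq[OF G(1)] by (auto simp: nbrs_def)
  have finS: "finite S" "finite P" using S(1) PV fin(2) finite_subset by blast+
  have S_edge: "\<exists>x\<in>P. ends G e = {x, y}" if "e \<in> edges G" "y \<in> S" "y \<in> ends G e" for e y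
  proof -
    obtain u v where "ends G e = {u, v}" using mgraph_edge[OF G(1) \<open>e \<in> edges G\<close>] by metis
    then have "ends G e = {v, y} \<or> ends G e = {u, y}" using that by auto
    then obtain x where "ends G e = {x, y}" by blast
    then show ?thesis using that unfolding P(1) nbrs_def by blast
  qed
  have sub: "(\<Union>y\<in>S. ?I y) \<subseteq> (\<Union>x\<in>P. ?I x)" using S_edge by fastforce
  \<comment> \<open>No edge has both ends in \<open>S\<close>, so the edges at \<open>S\<close> are
    counted without repetition.\<close>
  have "card (\<Union>y\<in>S. ?I y) = (\<Sum>y\<in>S. card (?I y))"
  proof (rule card_UN_disjoint)
    show "\<forall>i\<in>S. \<forall>j\<in>S. i \<noteq> j \<longrightarrow> ?I i \<inter> ?I j = {}"
    proof (intro ballI impI)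
      fix i j assume ij: "i \<in> S" "j \<in> S" "i \<noteq> j"
      show "?I i \<inter> ?I j = {}"
      proof (rule ccontr)
        assume "?I i \<inter> ?I j \<noteq> {}"
        then obtain e where e: "e \<in> edges G" "i \<in> ends G e" "j \<in> ends G e" by blast
        then obtain x where "x \<in> P" "ends G e = {x, i}" using S_edge ij by blast
        with e ij P(2) show False by auto
      qed
    qed
  qed (use finS fin in auto)
  also have "\<dots> = (\<Sum>y\<in>S. d)" using S(3) by (intro sum.cong) (auto simp: degree_def)
  finally have cS: "card (\<Union>y\<in>S. ?I y) = d * card S" by simp
  have le1: "card (\<Union>x\<in>P. ?I x) \<le> (\<Sum>x\<in>P. card (?I x))" using finS by (simp add: card_UN_le)
  have degP: "card (?I x) \<le> d" if "x \<in> P" for x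
    using d[of x] that PV by (auto simp: degree_def)
  then have le2: "(\<Sum>x\<in>P. card (?I x)) \<le> (\<Sum>x\<in>P. d)" by (intro sum_mono) auto
  have le3: "(\<Sum>x\<in>P. d) \<le> d * card S" using P(3) by simp
  have finU: "finite (\<Union>x\<in>P. ?I x)" using finS fin by auto
  have le0: "d * card S \<le> card (\<Union>x\<in>P. ?I x)" using card_mono[OF finU sub] cS by simp
  \<comment> \<open>The bounds \<open>le0\<close> to \<open>le3\<close> form a chain that starts and
    ends with \<open>d * card S\<close>, so all are equalities: every edge at \<open>P\<close> is an
    edge at \<open>S\<close>, and every vertex of \<open>P\<close> has degree
    \<open>d\<close>.\<close>
  have eqU: "(\<Union>y\<in>S. ?I y) = (\<Union>x\<in>P. ?I x)"
    using card_subset_eq[OF finU sub] cS le0 le1 le2 le3 by linarith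
  have eqs: "(\<Sum>x\<in>P. card (?I x)) = (\<Sum>x\<in>P. d)" using le0 le1 le2 le3 by linarith
  have degP': "degree G x = d" if "x \<in> P" for x
    using sum_mono_inv[OF eqs degP that finS(2)] by (simp add: degree_def)
  have all: "S \<union> P = verts G"
  proof (rule ccontr)
    assume "S \<union> P \<noteq> verts G"
    then obtain e u v where e: "e \<in> edges G" "u \<in> S \<union> P" "v \<notin> S \<union> P" "ends G e = {u, v}"
      using cut_connectedE[OF G(2), of "S \<union> P"] S PV by (metis Un_empty Un_least)
    then have "e \<in> (\<Union>y\<in>S. ?I y)" using eqU by blast
    then show False using e S_edge by fastforce
  qed
  have "regular G" unfolding regular_def using all degP' S(3) by blast
  moreover have "ordered_bipartition G P S"
    unfolding ordered_bipartition_def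
  proof (intro conjI ballI)
    fix e assume e: "e \<in> edges G"
    obtain u v where uv: "ends G e = {u, v}" "u \<in> verts G" using mgraph_edge[OF G(1) e] by metis
    then have "e \<in> (\<Union>y\<in>S. ?I y) \<union> (\<Union>x\<in>P. ?I x)" using all e by blast
    then obtain y where "y \<in> S" "y \<in> ends G e" unfolding eqU[symmetric] by blast
    then show "\<exists>x\<in>P. \<exists>y\<in>S. ends G e = {x, y}" using S_edge[OF e] by blast
  qed (use all P in auto)
  ultimately show ?thesis unfolding bipartite_def by blast
qed

text \<open>A minimal violation \<open>S\<close> of Hall's condition has the property that \<open>S - {y}\<close> together with
  the neighbours of \<open>S\<close> is connected, since otherwise both components would have a surplus
  of neighbours. Hence \<open>y\<close> can change sides without disconnecting the rest.\<close>

lemma move_vertex_cut_connected: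
  assumes G: "mgraph G" and cc: "cut_connected (ends G) (verts G) (cut_edges G X)"
    and S: "S \<subseteq> verts G - X" "y \<in> S"
    and viol: "card (nbrs (ends G) (cut_edges G X) S) \<le> card S"
    and min: "\<And>S'. S' \<subset> S \<Longrightarrow> S' \<noteq> {} \<Longrightarrow> card S' < card (nbrs (ends G) (cut_edges G X) S')"
    and e0: "e0 \<in> edges G" "ends G e0 = {y, y'}" "y' \<notin> X"
  shows "cut_connected (ends G) (verts G) (cut_edges G (insert y X))"
proof (rule cut_connectedI)
  let ?V = "verts G" and ?C = "cut_edges G X" and ?C' = "cut_edges G (insert y X)"
  let ?N = "nbrs (ends G) ?C"
  show "y \<in> ?V" using S by blast
  fix A assume A: "A \<subseteq> ?V" "A \<noteq> {}" "y \<notin> A"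
  show "\<exists>e\<in>?C'. \<exists>u\<in>A. \<exists>v\<in>?V - A. ends G e = {u, v}"
  proof (rule ccontr)
    assume no: "\<not> ?thesis"
    have same: "u \<in> A \<longleftrightarrow> v \<in> A" if "e \<in> ?C'" "ends G e = {u, v}" for e u v
    proof -
      have "u \<in> ?V" "v \<in> ?V" "ends G e = {v, u}"
        using mgraph_ends_neq[OF G, of e] that by (auto simp: cut_edges_def)
      then show ?thesis using no that by blast
    qed
    \<comment> \<open>A cut edge of \<open>X\<close> that is not at \<open>y\<close> remains a cut
      edge when \<open>y\<close> changes sides.\<close>
    have same': "u \<in> A \<longleftrightarrow> v \<in> A" if "e \<in> ?C" "ends G e = {u, v}" "u \<noteq> y" "v \<noteq> y" for e u v
    proof (rule same)
      have "e \<in> edges G" using that by (simp add: cut_edges_def)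
      then show "e \<in> ?C'" using cut_edges_iff[OF G _ that(2)] that by simp
    qed (rule that)
    have y': "y' \<in> ?V" "y' \<noteq> y" using mgraph_ends_neq[OF G e0(1,2)] by auto
    \<comment> \<open>The edge \<open>e0\<close> enters the new cut, so \<open>y'\<close> lies
      outside \<open>A\<close> together with \<open>y\<close>.\<close>
    have "e0 \<in> ?C'" using cut_edges_iff[OF G e0(1,2)] y' e0 by simp
    then have y'A: "y' \<notin> A" using same e0(2) A(3) by blast
    have NX: "?N S' \<subseteq> X" if "S' \<subseteq> ?V - X" for S'
      using that unfolding nbrs_def cut_edges_def by (auto simp: doubleton_eq_iff)
    have fin: "finite ?V" using G by (simp add: mgraph_def)
    have finN: "finite (?N S')" for S'
      by (rule finite_nbrs[OF G]) (auto simp: cut_edges_def)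
    have finS: "finite S" using S fin finite_subset by blast
    have ynN: "y \<notin> ?N S" using NX[OF S(1)] S by blast
    have side: "card S' < card (?N S')" if "S' \<subseteq> S - {y}" "S' \<noteq> {}" for S'
      using min[of S'] that S by blast
    \<comment> \<open>If \<open>A\<close> split the neighbours of \<open>S\<close>, the parts of
      \<open>S - {y}\<close> inside and outside \<open>A\<close> would each have a surplus on their
      own side, even when empty. Together \<open>S\<close> would have at least
      \<open>card S + 1\<close> neighbours.\<close>
    have "?N S \<inter> A = {} \<or> ?N S \<subseteq> A"
    proof (rule ccontr)
      assume c: "\<not> ?thesis"
      define S1 S2 where "S1 = (S - {y}) \<inter> A" and "S2 = (S - {y}) - A"
      have sep: "x \<in> A \<longleftrightarrow> z \<in> A" if "x \<in> ?N {z}" "z \<in> S - {y}" for x z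
      proof -
        obtain e where e: "e \<in> ?C" "ends G e = {x, z}" using \<open>x \<in> ?N {z}\<close> by (auto simp: nbrs_def)
        have "x \<in> ?N S" using that unfolding nbrs_def by blast
        then have "x \<noteq> y" using ynN by blast
        then show ?thesis using same'[OF e] that by blast
      qed
      have "?N S1 \<subseteq> ?N S \<inter> A" "?N S2 \<subseteq> ?N S - A"
        using sep unfolding S1_def S2_def nbrs_def by blast+
      then have le: "card (?N S1) \<le> card (?N S \<inter> A)" "card (?N S2) \<le> card (?N S - A)"
        using finN by (auto intro: card_mono)
      have "card (?N S \<inter> A) > 0" "card (?N S - A) > 0"
        using c finN[of S] by (auto simp: card_gt_0_iff)
      with le side[of S1] side[of S2] have "card S1 < card (?N S \<inter> A)" "card S2 < card (?N S - A)"
        unfolding S1_def S2_def by (metis Int_lower1 card.empty less_le_trans,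
            metis Diff_subset card.empty less_le_trans)
      moreover have "card S1 + card S2 = card S - 1"
        using card_Int_Diff[of "S - {y}" A] finS S unfolding S1_def S2_def by simp
      moreover have "card (?N S \<inter> A) + card (?N S - A) = card (?N S)"
        using card_Int_Diff[OF finN, of S A] by simp
      ultimately show False using viol by linarith
    qed
    then show False
    proof
      assume N: "?N S \<inter> A = {}"
      obtain e u v where e: "e \<in> ?C" "u \<in> A" "v \<in> ?V" "v \<notin> A" "ends G e = {u, v}"
        using cut_connectedE[OF cc, of A] A S by blast
      then have "v = y" using same'[OF e(1,5)] A by blast
      then have "u \<in> ?N S" using e S unfolding nbrs_def by blast
      with N e show False by blast
    next
      assume N: "?N S \<subseteq> A"
      \<comment> \<open>The other side is treated like \<open>A\<close>: a cut edge of
        \<open>X\<close> leaving it must go to \<open>y\<close>. It is nonempty because it contains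
        \<open>y'\<close>.\<close>
      let ?B = "?V - A - {y}"
      obtain e u v where e: "e \<in> ?C" "u \<in> ?B" "v \<in> ?V" "v \<notin> ?B" "ends G e = {u, v}"
        using cut_connectedE[OF cc, of ?B] y' y'A S by blast
      then have "v = y" using same'[OF e(1,5)] by blast
      then have "u \<in> ?N S" using e S unfolding nbrs_def by blast
      with N e show False by blast
    qed
  qed
qed

text \<open>In a violating set \<open>S\<close> of least size no vertex has a neighbour outside
  \<open>X\<close>, since by maximality of \<open>X\<close> it cannot be moved. So \<open>S\<close>
  has the same neighbours in the cut as in \<open>G\<close>, and edge counting applies.\<close>

lemma maximal_part_strict_hall:
  assumes G: "mgraph G" "cut_connected (ends G) (verts G) (edges G)"
    and nrb: "\<not> (regular G \<and> bipartite G)"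
    and d: "\<And>v. v \<in> verts G \<Longrightarrow> degree G v \<le> d"
    and X: "typed_part G w l X" "cut_connected (ends G) (verts G) (cut_edges G X)"
    and max: "\<And>X'. typed_part G w l X' \<Longrightarrow> cut_connected (ends G) (verts G) (cut_edges G X') \<Longrightarrow>
      card X' \<le> card X"
  shows "strict_hall (ends G) (cut_edges G X) {y \<in> verts G - X. degree G y = d}"
proof (rule ccontr)
  let ?D = "{y \<in> verts G - X. degree G y = d}"
  let ?N = "nbrs (ends G) (cut_edges G X)"
  let ?bad = "\<lambda>S. S \<subseteq> ?D \<and> S \<noteq> {} \<and> card (?N S) \<le> card S"
  assume "\<not> ?thesis"
  then obtain S0 where "?bad S0" unfolding strict_hall_def by (auto simp: not_less)
  then obtain S where S: "?bad S" and leS: "\<And>S'. ?bad S' \<Longrightarrow> card S \<le> card S'"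
    using ex_has_least_nat[of ?bad S0 card] by blast
  have fin: "finite (verts G)" using G by (simp add: mgraph_def)
  have finS: "finite S" using S fin by (auto intro: finite_subset)
  have min: "card S' < card (?N S')" if "S' \<subset> S" "S' \<noteq> {}" for S'
    using leS[of S'] psubset_card_mono[OF finS that(1)] that S by (meson leI leD order_trans psubset_imp_subset)
  have no_y: "y' \<in> X" if y: "y \<in> S" "e \<in> edges G" "ends G e = {y, y'}" for y y' e
  proof (rule ccontr)
    assume "y' \<notin> X"
    then have cc: "cut_connected (ends G) (verts G) (cut_edges G (insert y X))"
      using move_vertex_cut_connected[OF G(1) X(2), of S y e y'] S y min by blast
    \<comment> \<open>For \<open>l \<noteq> 0\<close> all neighbours of \<open>w\<close> lie in
      \<open>X\<close>, whereas \<open>y'\<close> does not.\<close>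
    have "y \<noteq> w" if "l \<noteq> 0"
    proof
      assume "y = w"
      then have "y' \<in> nbrs (ends G) (edges G) {w}" using y unfolding nbrs_def by blast
      then show False using X(1) that \<open>y' \<notin> X\<close> by (auto simp: typed_part_def)
    qed
    then have "typed_part G w l (insert y X)" using X(1) S y by (auto simp: typed_part_def)
    from max[OF this cc] have "card (insert y X) \<le> card X" .
    moreover have "finite X" using X(1) fin by (auto simp: typed_part_def intro: finite_subset)
    moreover have "y \<notin> X" using S y by blast
    ultimately show False by simp
  qed
  have "nbrs (ends G) (edges G) S = ?N S"
  proof
    show "nbrs (ends G) (edges G) S \<subseteq> ?N S"
    proof
      fix x assume "x \<in> nbrs (ends G) (edges G) S"
      then obtain e y where e: "e \<in> edges G" "y \<in> S" "ends G e = {x, y}" unfolding nbrs_def by blast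
      then have "x \<in> X" using no_y[of y e x] by blast
      moreover have "y \<in> verts G - X" using S e by blast
      ultimately have "e \<in> cut_edges G X" using e unfolding cut_edges_def by blast
      then show "x \<in> ?N S" using e unfolding nbrs_def by blast
    qed
  qed (auto simp: nbrs_def cut_edges_def)
  moreover have "?N S \<inter> S = {}"
    using S unfolding nbrs_def cut_edges_def by (auto simp: doubleton_eq_iff)
  moreover have "S \<subseteq> verts G" "\<And>y. y \<in> S \<Longrightarrow> degree G y = d" using S by auto
  ultimately show False
    using tight_set_regular_bipartite[OF G, of S d "?N S"] S d nrb by simp
qed

section \<open>Edges critical for the strict Hall condition\<close>

text \<open>A set \<open>A\<close> that violates the condition without \<open>e\<close> satisfies it
  with \<open>e\<close>, so deleting \<open>e\<close> costs \<open>A\<close> a neighbour. As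
  \<open>x\<close> is not in \<open>A\<close>, this neighbour is \<open>x\<close>, joined to
  \<open>A\<close> at \<open>y\<close>.\<close>

lemma strict_hall_critical_edge:
  assumes hall: "strict_hall en F D" and crit: "\<not> strict_hall en (F - {e}) D"
    and e: "e \<in> F" "en e = {x, y}" "x \<notin> D" and fin: "\<And>S. finite (nbrs en F S)"
  obtains A where "A \<subseteq> D" "y \<in> A" "card (nbrs en (F - {e}) A) \<le> card A"
    "x \<notin> nbrs en (F - {e}) A" "nbrs en F A \<subseteq> insert x (nbrs en (F - {e}) A)"
proof -
  obtain A where A: "A \<subseteq> D" "A \<noteq> {}" "card (nbrs en (F - {e}) A) \<le> card A"
    using crit unfolding strict_hall_def by (auto simp: not_less)
  then have big: "card A < card (nbrs en F A)" using hall unfolding strict_hall_def by blast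
  have xA: "x \<notin> A" using A e by blast
  have sub: "nbrs en F A \<subseteq> insert x (nbrs en (F - {e}) A)"
  proof
    fix z assume "z \<in> nbrs en F A"
    then obtain f a where f: "f \<in> F" "a \<in> A" "en f = {z, a}" unfolding nbrs_def by blast
    show "z \<in> insert x (nbrs en (F - {e}) A)"
    proof (cases "f = e")
      case True
      then show ?thesis using f e xA by (auto simp: doubleton_eq_iff)
    next
      case False
      then show ?thesis using f unfolding nbrs_def by blast
    qed
  qed
  have x: "x \<notin> nbrs en (F - {e}) A"
  proof
    assume "x \<in> nbrs en (F - {e}) A"
    then have "nbrs en F A \<subseteq> nbrs en (F - {e}) A" using sub by blast
    moreover have "nbrs en (F - {e}) A \<subseteq> nbrs en F A" by (auto simp: nbrs_def)
    ultimately show False using big A by simp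
  qed
  have "y \<in> A"
  proof (rule ccontr)
    assume "y \<notin> A"
    have "nbrs en F A = nbrs en (F - {e}) A"
    proof
      show "nbrs en F A \<subseteq> nbrs en (F - {e}) A"
      proof
        fix z assume "z \<in> nbrs en F A"
        then obtain f a where f: "f \<in> F" "a \<in> A" "en f = {z, a}" unfolding nbrs_def by blast
        then have "f \<noteq> e" using e xA \<open>y \<notin> A\<close> by (auto simp: doubleton_eq_iff)
        then show "z \<in> nbrs en (F - {e}) A" using f unfolding nbrs_def by blast
      qed
    qed (auto simp: nbrs_def)
    then show False using big A by simp
  qed
  then show thesis using that A x sub by blast
qed

text \<open>Submodularity: let \<open>A\<close> and \<open>B\<close> violate the condition after
  deletion of \<open>e1\<close> and of \<open>e2\<close>. With a third edge at \<open>y\<close>, the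
  inequalities for \<open>A \<union> B\<close> and \<open>A \<inter> B\<close> add up to
  \<open>card A + card B < card ?P + card ?Q\<close>, against the choice of \<open>A\<close> and
  \<open>B\<close>.\<close>

lemma strict_hall_two_critical_edges:
  assumes hall: "strict_hall en F D"
    and crit: "\<not> strict_hall en (F - {e1}) D" "\<not> strict_hall en (F - {e2}) D"
    and e: "e1 \<in> F" "en e1 = {a, y}" "a \<notin> D" "e2 \<in> F" "en e2 = {b, y}" "b \<notin> D" "e1 \<noteq> e2"
    and f: "f \<in> F" "en f = {c, y}" "f \<noteq> e1" "f \<noteq> e2"
    and fin: "finite D" "\<And>S. finite (nbrs en F S)"
  shows False
proof -
  obtain A where A: "A \<subseteq> D" "y \<in> A" "card (nbrs en (F - {e1}) A) \<le> card A"
    "nbrs en F A \<subseteq> insert a (nbrs en (F - {e1}) A)"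
    by (rule strict_hall_critical_edge[OF hall crit(1) e(1-3) fin(2)]) (rule that)
  obtain B where B: "B \<subseteq> D" "y \<in> B" "card (nbrs en (F - {e2}) B) \<le> card B"
    "nbrs en F B \<subseteq> insert b (nbrs en (F - {e2}) B)"
    by (rule strict_hall_critical_edge[OF hall crit(2) e(4-6) fin(2)]) (rule that)
  let ?P = "nbrs en (F - {e1}) A" and ?Q = "nbrs en (F - {e2}) B"
  let ?I = "A \<inter> B - {y}"
  have hallD: "card S < card (nbrs en F S)" if "S \<subseteq> D" "S \<noteq> {}" for S
    using hall that unfolding strict_hall_def by simp
  have finAB: "finite A" "finite B" using A B fin finite_subset by blast+
  have PF: "?P \<subseteq> nbrs en F A" "?Q \<subseteq> nbrs en F B" unfolding nbrs_def by blast+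
  then have finPQ: "finite ?P" "finite ?Q" using fin(2) finite_subset by blast+
  \<comment> \<open>As \<open>y\<close> lies in both sets, the neighbour lost to one is still
    reached from the other.\<close>
  have "a \<in> ?Q" "b \<in> ?P" using A(2) B(2) e unfolding nbrs_def by blast+
  moreover have "nbrs en F (A \<union> B) = nbrs en F A \<union> nbrs en F B" by (auto simp: nbrs_def)
  ultimately have "nbrs en F (A \<union> B) \<subseteq> ?P \<union> ?Q" using A(4) B(4) by blast
  then have "card (nbrs en F (A \<union> B)) \<le> card (?P \<union> ?Q)" using finPQ by (intro card_mono) auto
  moreover have "card (A \<union> B) < card (nbrs en F (A \<union> B))"
    using hallD[of "A \<union> B"] A(1,2) B(1) by blast
  ultimately have un: "card (A \<union> B) < card (?P \<union> ?Q)" by simp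
  \<comment> \<open>The third edge survives both deletions; its end \<open>c\<close> gives the
    strict inequality when \<open>?I\<close> is empty.\<close>
  have c: "c \<in> ?P \<inter> ?Q" using A(2) B(2) f unfolding nbrs_def by blast
  \<comment> \<open>Leaving out \<open>y\<close> ensures that no edge at \<open>?I\<close> is
    deleted. It costs one element, which the surplus makes up for.\<close>
  have "nbrs en F ?I \<subseteq> ?P \<inter> ?Q"
  proof
    fix x assume "x \<in> nbrs en F ?I"
    then obtain g z where g: "g \<in> F" "z \<in> ?I" "en g = {x, z}" unfolding nbrs_def by blast
    then have "z \<noteq> a" "z \<noteq> b" "z \<noteq> y" using A e by auto
    then have "g \<noteq> e1" "g \<noteq> e2" using g e by (auto simp: doubleton_eq_iff)
    then show "x \<in> ?P \<inter> ?Q" using g unfolding nbrs_def by blast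
  qed
  then have "card (nbrs en F ?I) \<le> card (?P \<inter> ?Q)" using finPQ by (intro card_mono) auto
  moreover have "?I \<noteq> {} \<Longrightarrow> card ?I < card (nbrs en F ?I)"
    using hallD[of ?I] A(1) by blast
  moreover have "card (?P \<inter> ?Q) > 0" using c finPQ by (auto simp: card_gt_0_iff)
  moreover have "?I = {} \<Longrightarrow> card ?I = 0" by (simp only: card.empty)
  ultimately have "card ?I < card (?P \<inter> ?Q)" by linarith
  moreover have "card (A \<inter> B) = Suc (card ?I)"
    using finAB A B by (intro card.remove) auto
  ultimately have "card (A \<inter> B) \<le> card (?P \<inter> ?Q)" by simp
  with un have "card A + card B < card ?P + card ?Q"
    using card_Un_Int[OF finAB] card_Un_Int[OF finPQ] by linarith
  with A(3) B(3) show False by linarith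
qed

section \<open>Edges and indexing of cycles\<close>

lemma walk_appendE:
  assumes "walk G u (p @ q) v"
  obtains x where "walk G u p x" "walk G x q v"
  using assms
proof (induction p arbitrary: u thesis)
  case Nil
  then show ?case using walk_verts by fastforce
next
  case (Cons s p)
  obtain e x where s: "s = (e, x)" by fastforce
  then obtain z where "walk G x p z" "walk G z q v" using Cons by auto
  then show ?case using Cons(2)[of z] Cons(3) s by simp
qed

text \<open>The rest of the cycle joins the ends of \<open>e\<close> without using \<open>e\<close>,
  since the edges of a cycle are distinct. A set that \<open>e\<close> leaves is thus left by
  another edge.\<close>

lemma cycle_edge_not_bridge:
  assumes G: "mgraph G" and cc: "cut_connected (ends G) (verts G) (edges G)"
    and cyc: "cycle G u p" and e: "e \<in> set (map fst p)"
  shows "cut_connected (ends G) (verts G) (edges G - {e})"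
  unfolding cut_connected_def
proof (intro allI impI)
  let ?V = "verts G"
  fix A assume A: "A \<subseteq> ?V \<and> A \<noteq> {} \<and> A \<noteq> ?V"
  obtain x where "(e, x) \<in> set p" using e by force
  then obtain p1 p2 where p: "p = p1 @ (e, x) # p2" by (meson split_list)
  obtain a where a: "walk G u p1 a" "walk G a ((e, x) # p2) u"
    using cyc p walk_appendE unfolding cycle_def by metis
  then have ex: "ends G e = {a, x}" "walk G x (p2 @ p1) a" using walk_append by fastforce+
  have ne: "e \<notin> set (map fst (p2 @ p1))" using cyc p unfolding cycle_def by auto
  obtain f b c where f: "f \<in> edges G" "b \<in> A" "c \<in> ?V" "c \<notin> A" "ends G f = {b, c}"
    using cut_connectedE[OF cc] A by metis
  show "\<exists>e'\<in>edges G - {e}. \<exists>u\<in>A. \<exists>v\<in>?V - A. ends G e' = {u, v}"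
  proof (cases "f = e")
    case False
    then show ?thesis using f by blast
  next
    case True
    then consider "x \<in> A" "a \<notin> A" | "a \<in> A" "x \<notin> A" using f ex by (auto simp: doubleton_eq_iff)
    then show ?thesis
    proof cases
      case 1
      then show ?thesis using walk_crosses[OF ex(2), of A] ne by (metis Diff_iff singletonD)
    next
      case 2
      have "x \<in> ?V" using walk_verts ex by metis
      then obtain e' b c where "e' \<in> set (map fst (p2 @ p1))" "e' \<in> edges G"
        "b \<in> ?V - A" "c \<in> ?V - (?V - A)" "ends G e' = {b, c}"
        using walk_crosses[OF ex(2), of "?V - A"] 2 by blast
      moreover have "{b, c} = {c, b}" by blast
      ultimately show ?thesis using ne by (metis Diff_iff singletonD)
    qed
  qed
qed

lemma walk_nth:
  assumes "walk G u p v" "i < length p"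
  shows "fst (p ! i) \<in> edges G"
    and "ends G (fst (p ! i)) = {if i = 0 then u else snd (p ! (i - 1)), snd (p ! i)}"
  using assms
proof (induction G u p v arbitrary: i rule: walk.induct)
  case (2 G u e x p v)
  { case 1
    then show ?case using 2(1) by (cases i) auto
  next
    case 2
    then show ?case using "2.IH"(2)[of "i - 1"] by (cases i) (auto simp: nth_Cons')
  }
qed auto

lemma walk_last: "walk G u p v \<Longrightarrow> p \<noteq> [] \<Longrightarrow> snd (last p) = v"
  by (induction G u p v rule: walk.induct) (auto split: if_splits elim: walk.elims)

text \<open>Cyclic indexing makes every vertex of a cycle have a predecessor and a successor.\<close>

lemma cycle_cyclic_indexing:
  assumes G: "mgraph G" and cyc: "cycle G u p"
  obtains n :: nat and vt ed where "n \<ge> 2" "inj_on vt {..<n}" "inj_on ed {..<n}"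
    "\<And>i. vt (i + n) = vt i" "\<And>i. ed (i + n) = ed i" "\<And>i. ed i \<in> set (map fst p)"
    "\<And>i. ed i \<in> edges G" "\<And>i. ends G (ed (Suc i)) = {vt i, vt (Suc i)}"
proof -
  define n where "n = length p"
  define vt where "vt = (\<lambda>i. snd (p ! (i mod n)))"
  \<comment> \<open>\<open>ed i\<close> is the edge by which the cycle enters \<open>vt i\<close>,
    hence the index shift in its ends.\<close>
  define ed where "ed = (\<lambda>i. fst (p ! (i mod n)))"
  have p: "p \<noteq> []" "walk G u p u" "distinct (map fst p)" "distinct (map snd p)"
    using cyc unfolding cycle_def by auto
  have n: "n > 0" using p n_def by simp
  have last: "snd (p ! (n - 1)) = u" using walk_last[OF p(2,1)] p(1) by (simp add: last_conv_nth n_def)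
  have ends: "ends G (ed (Suc i)) = {vt i, vt (Suc i)}" for i
  proof -
    have lt: "Suc i mod n < length p" using n n_def by simp
    have "(if Suc i mod n = 0 then u else snd (p ! (Suc i mod n - 1))) = vt i"
    proof (cases "Suc (i mod n) = n")
      case True
      then have "i mod n = n - 1" by linarith
      then show ?thesis using True last by (simp add: vt_def mod_Suc)
    qed (simp add: vt_def mod_Suc)
    then show ?thesis using walk_nth(2)[OF p(2) lt] unfolding ed_def vt_def by simp
  qed
  have edE: "ed i \<in> edges G" for i using walk_nth(1)[OF p(2), of "i mod n"] n n_def ed_def by simp
  \<comment> \<open>A cycle of length one would be a loop.\<close>
  have "n \<noteq> 1"
  proof
    assume "n = 1"
    then have "vt 0 = vt (Suc 0)" by (simp add: vt_def)
    then show False using mgraph_ends_neq(1)[OF G edE ends[of 0]] by simp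
  qed
  then have "n \<ge> 2" using n by simp
  moreover have "inj_on vt {..<n}"
    using p(4) by (auto simp: inj_on_def vt_def n_def distinct_conv_nth)
  moreover have "inj_on ed {..<n}"
    using p(3) by (auto simp: inj_on_def ed_def n_def distinct_conv_nth)
  moreover have "ed i \<in> set (map fst p)" for i using n by (simp add: ed_def n_def)
  ultimately show thesis
    using that[of n vt ed] ends edE by (simp add: vt_def ed_def)
qed

section \<open>Acyclicity of a minimal subgraph with the strict Hall condition\<close>

text \<open>On a cycle no edge is a bridge, so by minimality every edge is needed for Hall's condition.
  Then the cycle vertices outside \<open>X\<close> have degree two, all their neighbours are on the
  cycle, and there are too few of them.\<close>

lemma minimal_hall_subgraph_acyclic:
  assumes G: "mgraph G" and cc: "cut_connected (ends G) (verts G) (edges G)"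
    and bip: "\<And>e. e \<in> edges G \<Longrightarrow> \<exists>x\<in>X. \<exists>y\<in>verts G - X. ends G e = {x, y}"
    and D: "D \<subseteq> verts G - X" and hall: "strict_hall (ends G) (edges G) D"
    and min: "\<And>e. e \<in> edges G \<Longrightarrow> cut_connected (ends G) (verts G) (edges G - {e}) \<Longrightarrow>
      \<not> strict_hall (ends G) (edges G - {e}) D"
  shows "\<not> cycle G u p"
proof
  assume cyc: "cycle G u p"
  obtain n :: nat and vt ed where n: "n \<ge> 2" and inj: "inj_on vt {..<n}" "inj_on ed {..<n}"
    and per: "\<And>i. vt (i + n) = vt i" "\<And>i. ed (i + n) = ed i"
    and ed: "\<And>i. ed i \<in> set (map fst p)" "\<And>i. ed i \<in> edges G"
      "\<And>i. ends G (ed (Suc i)) = {vt i, vt (Suc i)}"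
    by (rule cycle_cyclic_indexing[OF G cyc]) (rule that)
  have finD: "finite D" using D G by (auto simp: mgraph_def intro: finite_subset)
  have finN: "finite (nbrs (ends G) (edges G) S)" for S by (rule finite_nbrs[OF G]) simp
  have crit: "\<not> strict_hall (ends G) (edges G - {ed i}) D" for i
    using min[OF ed(2)] cycle_edge_not_bridge[OF G cc cyc ed(1)] by blast
  have alt: "vt (Suc i) \<in> X \<longleftrightarrow> vt i \<notin> X" for i
    using bip[OF ed(2), of "Suc i"] ed(3)[of i] by (auto simp: doubleton_eq_iff)
  \<comment> \<open>The predecessor modulo \<open>n\<close>, written so that index 0 is no
    exception.\<close>
  define prv where "prv = (\<lambda>i. i + (n - 1))"
  have prv: "ends G (ed i) = {vt (prv i), vt i}" "vt (prv i) \<in> X \<longleftrightarrow> vt i \<notin> X" for i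
    using ed(3)[of "prv i"] alt[of "prv i"] per[of i] n unfolding prv_def by auto
  define J K where "J = {i. i < n \<and> vt i \<in> X}" and "K = {i. i < n \<and> vt i \<notin> X}"
  have fJK: "finite J" "finite K" by (simp_all add: J_def K_def)
  have vt_mod: "vt (i mod n) = vt i" for i
  proof -
    have "vt (j + m * n) = vt j" for j m
    proof (induction m)
      case (Suc m)
      have "j + Suc m * n = (j + m * n) + n" by simp
      then show ?case using per(1) Suc by metis
    qed simp
    then show ?thesis by (metis mod_div_mult_eq)
  qed
  have vt_J: "vt i \<in> vt ` J" if "vt i \<in> X" for i
    using that vt_mod[of i] n unfolding J_def by (auto intro!: image_eqI[of _ _ "i mod n"])
  \<comment> \<open>The set witnessing that the edge entering \<open>vt i\<close> is critical lies
    in \<open>D\<close> and contains \<open>vt i\<close>.\<close>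
  have KD: "vt ` K \<subseteq> D"
  proof
    fix y assume "y \<in> vt ` K"
    then obtain i where i: "y = vt i" "vt i \<notin> X" unfolding K_def by blast
    then have "vt (prv i) \<notin> D" using prv(2)[of i] D by blast
    then obtain A where "A \<subseteq> D" "vt i \<in> A"
      by (rule strict_hall_critical_edge[OF hall crit[of i] ed(2) prv(1) _ finN]) (rule that)
    then show "y \<in> D" using i(1) by blast
  qed
  have "nbrs (ends G) (edges G) (vt ` K) \<subseteq> vt ` J"
  proof
    fix x assume "x \<in> nbrs (ends G) (edges G) (vt ` K)"
    then obtain f i where f: "f \<in> edges G" "i < n" "vt i \<notin> X" "ends G f = {x, vt i}"
      unfolding nbrs_def K_def by blast
    have nb: "vt (prv i) \<in> X" "vt (Suc i) \<in> X" using alt prv(2) f by auto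
    have e2: "ends G (ed (Suc i)) = {vt (Suc i), vt i}" using ed(3)[of i] by blast
    \<comment> \<open>For \<open>i = n - 1\<close> the next edge is \<open>ed 0\<close>, and
      \<open>n \<ge> 2\<close> keeps the two apart.\<close>
    have "ed i \<noteq> ed (Suc i)"
    proof (cases "Suc i < n")
      case True
      then show ?thesis using inj_onD[OF inj(2), of i "Suc i"] f(2) by auto
    next
      case False
      then have "Suc i = n" using f(2) by linarith
      then have "ed (Suc i) = ed 0" using per(2)[of 0] by simp
      then show ?thesis using inj_onD[OF inj(2), of i 0] f(2) n False by auto
    qed
    moreover have "vt (prv i) \<notin> D" "vt (Suc i) \<notin> D" using nb D by auto
    \<comment> \<open>Both cycle edges at \<open>vt i\<close> are critical, so there is no third
      edge at \<open>vt i\<close>.\<close>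
    ultimately have "f = ed i \<or> f = ed (Suc i)"
      using strict_hall_two_critical_edges[OF hall crit[of i] crit[of "Suc i"] ed(2) prv(1) _ ed(2) e2 _ _
          f(1) f(4) _ _ finD finN] by metis
    then have "x = vt (prv i) \<or> x = vt (Suc i)"
      using f(4) prv(1)[of i] e2 by (auto simp: doubleton_eq_iff)
    then show "x \<in> vt ` J" using nb vt_J by blast
  qed
  then have "card (nbrs (ends G) (edges G) (vt ` K)) \<le> card (vt ` J)" using fJK by (intro card_mono) auto
  also have "\<dots> \<le> card J" using fJK by (intro card_image_le)
  \<comment> \<open>The two sides alternate along the cycle, so the cyclic successor maps
    \<open>J\<close> injectively into \<open>K\<close>.\<close>
  also have "\<dots> \<le> card K"
  proof (rule card_inj_on_le)
    show "inj_on (\<lambda>i. Suc i mod n) J"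
      by (auto simp: inj_on_def J_def mod_Suc split: if_splits)
    show "(\<lambda>i. Suc i mod n) ` J \<subseteq> K"
      using n alt vt_mod by (auto simp: J_def K_def)
  qed (rule fJK)
  also have "\<dots> = card (vt ` K)"
    using inj(1) by (intro card_image[symmetric]) (auto simp: inj_on_def K_def)
  finally have "\<not> card (vt ` K) < card (nbrs (ends G) (edges G) (vt ` K))" by simp
  moreover have "K \<noteq> {}"
    using alt[of 0] n unfolding K_def by (cases "vt 0 \<in> X") (auto intro: exI[of _ 0] exI[of _ 1])
  ultimately show False using hall KD unfolding strict_hall_def by blast
qed

section \<open>The spanning tree from the two extremal choices\<close>

theorem theorem1p4:
  fixes G :: "('a, 'e) mgraph" and w :: 'a and l :: nat
  assumes "mgraph G"
    and "edge_connected 2 G"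
    and "\<not> (regular G \<and> bipartite G)"
    and "w \<in> verts G"
    and "l \<in> {0, 1}"
  shows "\<exists>T X Y. spanning_subgraph T G \<and> wt_tree T X Y w l \<and> weakly_even G T X Y"
proof -
  let ?V = "verts G" and ?en = "ends G"
  note G = assms(1)
  have fin: "finite ?V" "finite (edges G)" using G by (auto simp: mgraph_def)
  have "connected (delete_edges G {})"
    using assms(2) unfolding edge_connected_def by (metis card.empty empty_subsetI zero_less_numeral)
  then have cc: "cut_connected ?en ?V (edges G)"
    using connected_cut_connected by (fastforce simp: delete_edges_def)
  have deg: "degree G v \<le> max_degree G" if "v \<in> ?V" for v
    unfolding max_degree_def using fin that by (intro Max_ge) auto
  let ?P = "\<lambda>X. typed_part G w l X \<and> cut_connected ?en ?V (cut_edges G X)"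
  have "\<forall>X. ?P X \<longrightarrow> card X < Suc (card ?V)"
    using fin by (auto simp: typed_part_def less_Suc_eq_le intro: card_mono)
  moreover obtain X0 where "?P X0" using exists_connected_cut[OF G cc assms(4)] by blast
  ultimately have "\<exists>X. ?P X \<and> (\<forall>X'. ?P X' \<longrightarrow> card X' \<le> card X)"
    by (rule ex_has_greatest_nat[rotated])
  then obtain X where X: "?P X" and maxX: "\<And>X'. ?P X' \<Longrightarrow> card X' \<le> card X" by blast
  define D where "D = {y \<in> ?V - X. degree G y = max_degree G}"
  have hall0: "strict_hall ?en (cut_edges G X) D"
    unfolding D_def using maximal_part_strict_hall[OF G cc assms(3) deg] X maxX by blast
  \<comment> \<open>A smallest \<open>F\<close> with these properties loses connectivity or the
    strict Hall condition with the removal of any edge, which excludes cycles.\<close>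
  let ?Q = "\<lambda>F. F \<subseteq> cut_edges G X \<and> cut_connected ?en ?V F \<and> strict_hall ?en F D"
  have "?Q (cut_edges G X)" using X hall0 by blast
  then have "\<exists>F. ?Q F \<and> (\<forall>F'. ?Q F' \<longrightarrow> card F \<le> card F')" by (rule ex_has_least_nat)
  then obtain F where F: "?Q F" and minF: "\<And>F'. ?Q F' \<Longrightarrow> card F \<le> card F'" by blast
  have FE: "F \<subseteq> edges G" using F by (auto simp: cut_edges_def)
  then have finF: "finite F" using fin finite_subset by blast
  define T where "T = G\<lparr>edges := F\<rparr>"
  have T[simp]: "verts T = ?V" "edges T = F" "ends T = ?en" by (auto simp: T_def)
  have mT: "mgraph T" using G FE finF by (auto simp: mgraph_def)
  have sub: "subgraph T G" unfolding subgraph_def using G mT FE by auto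
  have bip: "ordered_bipartition T X (?V - X)"
    using F X unfolding ordered_bipartition_def by (auto simp: cut_edges_def typed_part_def)
  have "\<not> cycle T u p" for u p
  proof (rule minimal_hall_subgraph_acyclic[OF mT])
    show "\<exists>x\<in>X. \<exists>y\<in>verts T - X. ends T e = {x, y}" if "e \<in> edges T" for e
      using bip that by (auto simp: ordered_bipartition_def)
    show "\<not> strict_hall (ends T) (edges T - {e}) D"
      if "e \<in> edges T" "cut_connected (ends T) (verts T) (edges T - {e})" for e
      using minF[of "F - {e}"] that F card_Diff1_less[OF finF] by fastforce
  qed (use F in \<open>auto simp: D_def\<close>)
  moreover have "connected T" using cut_connected_connected[of T] F assms(4) by auto
  ultimately have tree: "tree T" unfolding tree_def using mT by blast
  have type: "has_type X (?V - X) w l"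
    using X assms(4,5) by (auto simp: has_type_def typed_part_def)
  \<comment> \<open>Outside \<open>X\<close> such a leaf would belong to \<open>D\<close>. The
    strict Hall condition for \<open>{v}\<close> then demands two neighbours, but its only edge
    supplies one.\<close>
  have "has_type X (?V - X) v 0" if v: "leaf T v" "degree G v = max_degree G" for v
  proof (rule ccontr)
    assume "\<not> ?thesis"
    then have "v \<in> D" using v by (auto simp: has_type_def leaf_def D_def)
    moreover have "strict_hall ?en F D" using F by simp
    then have "{v} \<subseteq> D \<and> {v} \<noteq> {} \<longrightarrow> card {v} < card (nbrs ?en F {v})"
      unfolding strict_hall_def by (rule spec)
    ultimately have two: "1 < card (nbrs ?en F {v})" by simp
    have "card {e \<in> F. v \<in> ?en e} = 1" using v(1) by (simp add: leaf_def degree_def)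
    then obtain e where e: "{e \<in> F. v \<in> ?en e} = {e}" by (rule card_1_singletonE)
    have "nbrs ?en F {v} \<subseteq> ?en e - {v}"
    proof
      fix x assume "x \<in> nbrs ?en F {v}"
      then obtain f where f: "f \<in> F" "?en f = {x, v}" unfolding nbrs_def by blast
      then have "f = e" using e by blast
      then show "x \<in> ?en e - {v}" using f mgraph_ends_neq(1)[OF G, of f x v] FE by auto
    qed
    moreover have "card (?en e - {v}) = 1" "finite (?en e - {v})"
    proof -
      have "e \<in> F" "v \<in> ?en e" using e by blast+
      moreover from this have "card (?en e) = 2" using mT by (auto simp: mgraph_def)
      ultimately show "card (?en e - {v}) = 1" by simp
      then show "finite (?en e - {v})" by (intro card_ge_0_finite) simp
    qed
    ultimately show False using two card_mono[of "?en e - {v}" "nbrs ?en F {v}"] by linarith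
  qed
  then have "weakly_even G T X (?V - X)" unfolding weakly_even_def using tree sub bip by blast
  moreover have "wt_tree T X (?V - X) w l"
    unfolding wt_tree_def wt_bipartition_def using tree type bip assms(4) by simp
  moreover have "spanning_subgraph T G" unfolding spanning_subgraph_def using sub by simp
  ultimately show ?thesis by blast
qed

end
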